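(* Let $q\ge 2$ and $s\ge 2$ be integers, let $a_1\ge a_2\ge\cdots\ge a_s\ge 1$ be integers, and define $H_i:=K_{a_1}+\cdots+K_{a_i}$ for $1\le i\le s$. If $R_q(a_1-a_s+1,a_1,\ldots,a_1)>q(a_1+\cdots+a_{s-1})$, then $H_s$ and $H_{s-1}$ are $q$-equivalent.
   Context: All graphs are finite and simple; $G+H$ is the vertex-disjoint union. For positive integers $k_1,\dots,k_q$, $R_q(k_1,\dots,k_q)$ is the smallest $n$ such that every colouring of the edges of $K_n$ with colours $[q]$ contains, for some $i\in[q]$, a copy of $K_{k_i}$ all of whose edges have colour $i$ (a single vertex counts as a copy of $K_1$ in any colour); $R_q(k_1,k_2,\ldots,k_2)$ means $k_2=\dots=k_q$. A graph $G$ is $q$-Ramsey for $H$ if every $q$-colouring of $E(G)$ contains a monochromatic copy of $H$; $G$ is $q$-Ramsey-minimal for $H$ if it is $q$-Ramsey for $H$ but no proper subgraph is; $\mathcal{M}_q(H)$ is the set of such graphs. $H,H'$ are $q$-equivalent if $\mathcal{M}_q(H)=\mathcal{M}_q(H')$. *)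

theory Defs
  imports Complex_Main "HOL-Library.Ramsey"
begin

text \<open>A graph is a pair of a vertex set and a set of two-element vertex sets.\<close>

type_synonym 'a ugraph = "'a set \<times> 'a set set"

abbreviation verts :: "'a ugraph \<Rightarrow> 'a set" where
  "verts \<equiv> fst"

abbreviation edges :: "'a ugraph \<Rightarrow> 'a set set" where
  "edges \<equiv> snd"

definition finite_simple_graph :: "'a ugraph \<Rightarrow> bool" where
  "finite_simple_graph G \<longleftrightarrow> finite (verts G) \<and> edges G \<subseteq> [verts G]\<^bsup>2\<^esup>"

definition subgraph :: "'a ugraph \<Rightarrow> 'a ugraph \<Rightarrow> bool" where
  "subgraph G' G \<longleftrightarrow>
     finite_simple_graph G' \<and> verts G' \<subseteq> verts G \<and> edges G' \<subseteq> edges G"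

definition isomorphic :: "'a ugraph \<Rightarrow> 'b ugraph \<Rightarrow> bool" where
  "isomorphic G H \<longleftrightarrow>
     (\<exists>f. bij_betw f (verts G) (verts H) \<and> edges H = (\<lambda>e. f ` e) ` edges G)"

definition complete_graph :: "'a set \<Rightarrow> 'a ugraph" where
  "complete_graph V = (V, [V]\<^bsup>2\<^esup>)"

definition disjoint_union :: "'i set \<Rightarrow> ('i \<Rightarrow> 'a ugraph) \<Rightarrow> ('i \<times> 'a) ugraph" where
  "disjoint_union I G =
     (SIGMA i:I. verts (G i), \<Union>i\<in>I. (\<lambda>e. Pair i ` e) ` edges (G i))"

text \<open>The graph $H_i = K_{a_1} + \cdots + K_{a_i}$.\<close>

definition clique_sum :: "(nat \<Rightarrow> nat) \<Rightarrow> nat \<Rightarrow> (nat \<times> nat) ugraph" where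
  "clique_sum a i = disjoint_union {1..i} (\<lambda>j. complete_graph {..<a j})"

text \<open>The $q$ colours are the numbers below $q$, as in \<^const>\<open>partn_lst\<close>.\<close>

definition is_ramsey :: "nat \<Rightarrow> 'a ugraph \<Rightarrow> 'b ugraph \<Rightarrow> bool" where
  "is_ramsey q G H \<longleftrightarrow>
     (\<forall>c \<in> edges G \<rightarrow> {..<q}.
        \<exists>i<q. \<exists>S. subgraph S G \<and> isomorphic H S \<and> (\<forall>e\<in>edges S. c e = i))"

definition ramsey_minimal :: "nat \<Rightarrow> 'b ugraph \<Rightarrow> 'a ugraph set" where
  "ramsey_minimal q H =
     {G. finite_simple_graph G \<and> is_ramsey q G H \<and>
         (\<forall>G'. subgraph G' G \<and> G' \<noteq> G \<longrightarrow> \<not> is_ramsey q G' H)}"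

text \<open>
  The first argument names the vertex type of the host graphs. Taking it to be \<^typ>\<open>nat\<close>
  already covers every finite graph up to isomorphism.
\<close>

definition q_equivalent :: "'v itself \<Rightarrow> nat \<Rightarrow> 'a ugraph \<Rightarrow> 'b ugraph \<Rightarrow> bool" where
  "q_equivalent _ q H H' \<longleftrightarrow>
     (ramsey_minimal q H :: 'v ugraph set) = ramsey_minimal q H'"

text \<open>
  The list \<open>ks\<close> is $k_1,\ldots,k_q$. A set of one vertex spans no edges, so it counts as a
  monochromatic $K_1$ in any colour. By Ramsey's theorem the minimum is attained.
\<close>

definition ramsey_number :: "nat list \<Rightarrow> nat" where
  "ramsey_number ks = (LEAST n. partn_lst {..<n} ks 2)"

lemma partn_lst_ramsey_number: "partn_lst {..<ramsey_number ks} ks 2"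
  unfolding ramsey_number_def using ramsey_full[of ks 2] by (rule LeastI_ex)

end

theory Submission
  imports Defs "HOL-Library.Disjoint_Sets" "HOL-Combinatorics.Transposition"
begin

text \<open>
  Let \<open>G\<close> be $q$-Ramsey for $H_{s-1}$ and suppose that some colouring of \<open>G\<close> has no monochromatic
  $H_s$. For each colour \<open>i\<close> fix a copy of $H_j$ in colour \<open>i\<close> with \<open>j < s\<close> as large as possible and
  let $V_0$ be the union of the vertex sets of these copies, so that
  $|V_0| \le q(a_1+\cdots+a_{s-1})$. By maximality no $K_{a_1}$ of colour \<open>i\<close> avoids $V_0$. Some
  colour \<open>r\<close> has a copy of $H_{s-1}$, so not even a $K_{a_s}$ of colour \<open>r\<close> avoids $V_0$. Now recolour:
  inside $V_0$ use a colouring without $K_{a_1-a_s+1}$ in colour \<open>r\<close> and without $K_{a_1}$ in the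
  other colours, give colour \<open>r\<close> to all edges between $V_0$ and its complement, and keep the
  colours outside $V_0$. A monochromatic $K_{a_1}$ in a colour other than \<open>r\<close> would lie inside or outside $V_0$, and one in colour \<open>r\<close> would have at most
  $a_1-a_s$ vertices inside $V_0$, hence at least $a_s$ outside. So the new colouring has no
  monochromatic $K_{a_1}$, and in particular no monochromatic $H_{s-1}$.
\<close>

section \<open>Packings of vertex-disjoint cliques\<close>

text \<open>The edge set is a separate argument so that it can be a colour class. Edges between
  different \<open>C k\<close> are unrestricted, since copies need not be induced.\<close>

definition clique_packing ::
    "(nat \<Rightarrow> nat) \<Rightarrow> nat \<Rightarrow> 'a set \<Rightarrow> 'a set set \<Rightarrow> (nat \<Rightarrow> 'a set) \<Rightarrow> bool" where
  "clique_packing a j V E C \<longleftrightarrow>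
     (\<forall>k\<in>{1..j}. C k \<in> [V]\<^bsup>a k\<^esup> \<and> [C k]\<^bsup>2\<^esup> \<subseteq> E) \<and> disjoint_family_on C {1..j}"

lemma clique_packing_mono:
  assumes "clique_packing a j V E C" and "j' \<le> j"
  shows "clique_packing a j' V E C"
proof -
  have "{1..j'} \<subseteq> {1..j}" using assms(2) by simp
  then show ?thesis
    using assms(1) disjoint_family_on_mono[of "{1..j'}" "{1..j}" C] unfolding clique_packing_def by blast
qed

text \<open>A subset of a clique is a clique, so \<open>K\<close> can be trimmed to the exact size.
  Used contrapositively: outside a packing that cannot be continued, every clique is small.\<close>

lemma clique_packing_extend:
  assumes "clique_packing a j V E C"
    and "K \<subseteq> V" "finite K" "a (Suc j) \<le> card K" "[K]\<^bsup>2\<^esup> \<subseteq> E"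
    and "K \<inter> (\<Union>k\<in>{1..j}. C k) = {}"
  shows "\<exists>C'. clique_packing a (Suc j) V E C'"
proof -
  obtain K' where K': "K' \<subseteq> K" "card K' = a (Suc j)" "finite K'"
    using obtain_subset_with_card_n[OF assms(4)] by blast
  have "[K']\<^bsup>2\<^esup> \<subseteq> E"
    using K'(1) assms(5) nsets_mono by blast
  moreover have "K' \<in> [V]\<^bsup>a (Suc j)\<^esup>"
    using K' assms(2) by (auto simp: nsets_def)
  moreover have "disjoint_family_on (C(Suc j := K')) {1..Suc j}"
  proof -
    have "C k \<inter> K' = {}" if "k \<in> {1..j}" for k
      using assms(6) K'(1) that by blast
    then show ?thesis
      using assms(1) unfolding clique_packing_def
      by (auto simp: disjoint_family_on_def atLeastAtMostSuc_conv Int_commute)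
  qed
  ultimately have "clique_packing a (Suc j) V E (C(Suc j := K'))"
    using assms(1) by (auto simp: clique_packing_def atLeastAtMostSuc_conv)
  then show ?thesis by blast
qed

lemma clique_packing_card:
  assumes "clique_packing a j V E C"
  shows "finite (\<Union>k\<in>{1..j}. C k)" "card (\<Union>k\<in>{1..j}. C k) = (\<Sum>k=1..j. a k)"
proof -
  have C: "finite (C k)" "card (C k) = a k" if "k \<in> {1..j}" for k
    using assms that unfolding clique_packing_def nsets_def by auto
  then show "finite (\<Union>k\<in>{1..j}. C k)" by blast
  have "card (\<Union>k\<in>{1..j}. C k) = (\<Sum>k\<in>{1..j}. card (C k))"
    using assms C by (intro card_UN_disjoint) (auto simp: clique_packing_def disjoint_family_on_def)
  then show "card (\<Union>k\<in>{1..j}. C k) = (\<Sum>k=1..j. a k)"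
    using C by simp
qed

section \<open>Copies of clique sums as packings\<close>

lemma verts_clique_sum: "verts (clique_sum a j) = (SIGMA k:{1..j}. {..<a k})"
  by (simp add: clique_sum_def disjoint_union_def complete_graph_def)

lemma edges_clique_sum:
  "edges (clique_sum a j) = (\<Union>k\<in>{1..j}. (\<lambda>e. Pair k ` e) ` [{..<a k}]\<^bsup>2\<^esup>)"
  by (simp add: clique_sum_def disjoint_union_def complete_graph_def)

lemma image_nsets:
  assumes "inj_on f A"
  shows "(`) f ` [A]\<^bsup>n\<^esup> = [f ` A]\<^bsup>n\<^esup>"
  using bij_betw_nsets[of f A "f ` A" n] assms by (simp add: bij_betw_def)

lemma image_edges_clique_sum:
  assumes "inj_on f (verts (clique_sum a j))"
  shows "(`) f ` edges (clique_sum a j) = (\<Union>k\<in>{1..j}. [f ` Pair k ` {..<a k}]\<^bsup>2\<^esup>)"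
proof -
  have "(`) f ` (\<lambda>e. Pair k ` e) ` [{..<a k}]\<^bsup>2\<^esup> = [f ` Pair k ` {..<a k}]\<^bsup>2\<^esup>" if "k \<in> {1..j}" for k
  proof -
    have "inj_on f (Pair k ` {..<a k})"
      using that by (intro inj_on_subset[OF assms]) (auto simp: verts_clique_sum)
    then show ?thesis
      by (simp add: image_nsets inj_on_def)
  qed
  then show ?thesis
    by (simp add: edges_clique_sum image_UN)
qed

text \<open>The images of the summands under an isomorphism form a packing; conversely, bijections
  onto the cliques of a packing glue to an isomorphism. Later arguments can thus ignore
  isomorphisms.\<close>

lemma mono_copy_iff_clique_packing:
  fixes G :: "'v ugraph"
  assumes "finite_simple_graph G"
  shows "(\<exists>S. subgraph S G \<and> isomorphic (clique_sum a j) S \<and> (\<forall>e\<in>edges S. c e = i)) \<longleftrightarrow>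
         (\<exists>C. clique_packing a j (verts G) {e \<in> edges G. c e = i} C)"
proof
  assume "\<exists>S. subgraph S G \<and> isomorphic (clique_sum a j) S \<and> (\<forall>e\<in>edges S. c e = i)"
  then obtain S f where S: "subgraph S G" "\<forall>e\<in>edges S. c e = i"
    and f: "bij_betw f (verts (clique_sum a j)) (verts S)"
      "edges S = (`) f ` edges (clique_sum a j)"
    unfolding isomorphic_def by auto
  define C where "C k = f ` Pair k ` {..<a k}" for k
  have inj: "inj_on f (SIGMA k:{1..j}. {..<a k})"
    and im: "f ` (SIGMA k:{1..j}. {..<a k}) = verts S"
    using f(1) by (auto simp: bij_betw_def verts_clique_sum)
  have edges: "edges S = (\<Union>k\<in>{1..j}. [C k]\<^bsup>2\<^esup>)"
    using f image_edges_clique_sum[of f a j] by (simp add: bij_betw_def C_def)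
  have "C k \<in> [verts G]\<^bsup>a k\<^esup>" if "k \<in> {1..j}" for k
  proof -
    have "inj_on f (Pair k ` {..<a k})"
      using that by (intro inj_on_subset[OF inj]) auto
    then have "card (C k) = a k"
      unfolding C_def by (simp add: card_image inj_on_def)
    moreover have "C k \<subseteq> verts S"
      using that unfolding C_def im[symmetric] by blast
    ultimately show ?thesis
      using S(1) by (auto simp: nsets_def subgraph_def C_def)
  qed
  moreover have "disjoint_family_on C {1..j}"
    unfolding disjoint_family_on_def
  proof (intro ballI impI)
    fix k k' assume k: "k \<in> {1..j}" "k' \<in> {1..j}" "k \<noteq> k'"
    have "Pair k ` {..<a k} \<inter> Pair k' ` {..<a k'} = {}"
      using k(3) by blast
    moreover have "C k \<inter> C k' = f ` (Pair k ` {..<a k} \<inter> Pair k' ` {..<a k'})"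
      unfolding C_def using k by (intro inj_on_image_Int[OF inj, symmetric]) auto
    ultimately show "C k \<inter> C k' = {}" by simp
  qed
  moreover have "[C k]\<^bsup>2\<^esup> \<subseteq> {e \<in> edges G. c e = i}" if "k \<in> {1..j}" for k
  proof -
    have "[C k]\<^bsup>2\<^esup> \<subseteq> edges S"
      unfolding edges using that by (rule UN_upper)
    then show ?thesis
      using S by (auto simp: subgraph_def)
  qed
  ultimately show "\<exists>C. clique_packing a j (verts G) {e \<in> edges G. c e = i} C"
    unfolding clique_packing_def by blast
next
  assume "\<exists>C. clique_packing a j (verts G) {e \<in> edges G. c e = i} C"
  then obtain C where C: "\<And>k. k \<in> {1..j} \<Longrightarrow> C k \<in> [verts G]\<^bsup>a k\<^esup>"
      "\<And>k. k \<in> {1..j} \<Longrightarrow> [C k]\<^bsup>2\<^esup> \<subseteq> {e \<in> edges G. c e = i}"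
    and disj: "disjoint_family_on C {1..j}"
    unfolding clique_packing_def by blast
  have "\<exists>h. bij_betw h {..<a k} (C k)" if "k \<in> {1..j}" for k
    using C(1)[OF that] ex_bij_betw_nat_finite[of "C k"] by (auto simp: nsets_def atLeast0LessThan)
  then obtain h where h: "\<And>k. k \<in> {1..j} \<Longrightarrow> bij_betw (h k) {..<a k} (C k)"
    by metis
  define f where "f = (\<lambda>(k, x). h k x)"
  \<comment> \<open>Only edges inside the cliques are kept; \<open>G\<close> may have further edges
    of colour \<open>i\<close> between them.\<close>
  define S where "S = (\<Union>k\<in>{1..j}. C k, \<Union>k\<in>{1..j}. [C k]\<^bsup>2\<^esup>)"
  have fC: "f ` Pair k ` {..<a k} = C k" if "k \<in> {1..j}" for k
    using h[OF that] by (simp add: f_def bij_betw_def image_image)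
  have "inj_on f (SIGMA k:{1..j}. {..<a k})"
  proof (rule inj_onI)
    fix p p'
    assume "p \<in> (SIGMA k:{1..j}. {..<a k})" "p' \<in> (SIGMA k:{1..j}. {..<a k})" "f p = f p'"
    then obtain k x k' x' where p: "p = (k, x)" "p' = (k', x')"
      and kx: "k \<in> {1..j}" "k' \<in> {1..j}" "x \<in> {..<a k}" "x' \<in> {..<a k'}"
      and eq: "h k x = h k' x'"
      by (auto simp: f_def)
    have "h k x \<in> C k" "h k' x' \<in> C k'"
      using h kx by (auto simp: bij_betw_def)
    then have "k = k'"
      using eq disjoint_family_onD[OF disj kx(1,2)] by auto
    moreover have "x = x'"
      using eq h[OF kx(1)] kx(3,4) unfolding \<open>k = k'\<close> by (auto simp: bij_betw_def inj_on_def)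
    ultimately show "p = p'" by (simp add: p)
  qed
  then have inj: "inj_on f (verts (clique_sum a j))"
    by (simp add: verts_clique_sum)
  have "f ` verts (clique_sum a j) = (\<Union>k\<in>{1..j}. f ` Pair k ` {..<a k})"
    by (force simp: verts_clique_sum)
  then have "f ` verts (clique_sum a j) = verts S"
    using fC by (simp add: S_def)
  moreover have "edges S = (`) f ` edges (clique_sum a j)"
    unfolding image_edges_clique_sum[OF inj] using fC by (simp add: S_def)
  ultimately have "isomorphic (clique_sum a j) S"
    using inj unfolding isomorphic_def bij_betw_def by blast
  moreover have "subgraph S G"
  proof -
    have "finite (C k)" "C k \<subseteq> verts G" if "k \<in> {1..j}" for k
      using C(1)[OF that] by (auto simp: nsets_def)
    then have "finite (verts S)" "verts S \<subseteq> verts G"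
      unfolding S_def fst_conv by blast+
    moreover have "edges S \<subseteq> [verts S]\<^bsup>2\<^esup>"
      by (auto simp: S_def nsets_def)
    moreover have "edges S \<subseteq> edges G"
      unfolding S_def snd_conv using C(2) by blast
    ultimately show ?thesis
      by (simp add: subgraph_def finite_simple_graph_def)
  qed
  moreover have "\<forall>e\<in>edges S. c e = i"
    unfolding S_def snd_conv using C(2) by blast
  ultimately show "\<exists>S. subgraph S G \<and> isomorphic (clique_sum a j) S \<and> (\<forall>e\<in>edges S. c e = i)"
    by blast
qed

lemma is_ramsey_clique_sum_iff:
  fixes G :: "'v ugraph"
  assumes "finite_simple_graph G"
  shows "is_ramsey q G (clique_sum a j) \<longleftrightarrow>
    (\<forall>c \<in> edges G \<rightarrow> {..<q}. \<exists>i<q. \<exists>C. clique_packing a j (verts G) {e \<in> edges G. c e = i} C)"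
  unfolding is_ramsey_def mono_copy_iff_clique_packing[OF assms] ..

section \<open>Colourings below the Ramsey number\<close>

text \<open>By minimality of the Ramsey number, \<open>{..<card V}\<close> has a bad colouring,
  which a bijection carries over to \<open>V\<close>.\<close>

lemma critical_colouring:
  assumes "finite V" and "card V < ramsey_number ks"
  obtains g where "g \<in> [V]\<^bsup>2\<^esup> \<rightarrow> {..<length ks}"
    and "\<And>i K. i < length ks \<Longrightarrow> K \<in> [V]\<^bsup>(ks ! i)\<^esup> \<Longrightarrow> \<not> g ` [K]\<^bsup>2\<^esup> \<subseteq> {i}"
proof -
  have "\<not> partn_lst {..<card V} ks 2"
    using assms(2) not_less_Least unfolding ramsey_number_def by blast
  then obtain g where g: "g \<in> [{..<card V}]\<^bsup>2\<^esup> \<rightarrow> {..<length ks}"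
    and no: "\<And>i K. i < length ks \<Longrightarrow> K \<in> [{..<card V}]\<^bsup>(ks ! i)\<^esup> \<Longrightarrow> \<not> g ` [K]\<^bsup>2\<^esup> \<subseteq> {i}"
    unfolding partn_lst_def monochromatic_def by blast
  obtain h where h: "bij_betw h V {..<card V}"
    using ex_bij_betw_finite_nat[OF assms(1)] by (auto simp: atLeast0LessThan)
  define g' where "g' e = g (h ` e)" for e
  have him: "(`) h ` [V]\<^bsup>n\<^esup> = [{..<card V}]\<^bsup>n\<^esup>" for n
    using bij_betw_nsets[OF h] by (simp add: bij_betw_def)
  show thesis
  proof
    show "g' \<in> [V]\<^bsup>2\<^esup> \<rightarrow> {..<length ks}"
      using g him[of 2] unfolding g'_def by blast
    fix i K
    assume i: "i < length ks" and K: "K \<in> [V]\<^bsup>(ks ! i)\<^esup>"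
    have "inj_on h K"
      using h K by (auto simp: bij_betw_def nsets_def intro: inj_on_subset)
    then have "g' ` [K]\<^bsup>2\<^esup> = g ` [h ` K]\<^bsup>2\<^esup>"
      by (simp add: g'_def image_image flip: image_nsets)
    moreover have "h ` K \<in> [{..<card V}]\<^bsup>(ks ! i)\<^esup>"
      using K him by blast
    ultimately show "\<not> g' ` [K]\<^bsup>2\<^esup> \<subseteq> {i}"
      using no[OF i] by simp
  qed
qed

text \<open>The exceptional size \<open>k\<close> belongs to colour 0 in the list; swapping colours
  0 and \<open>r\<close> moves it to \<open>r\<close>.\<close>

lemma critical_colouring_special_colour:
  assumes "finite V" and "card V < ramsey_number (k # replicate (q - 1) m)" and "r < q"
  obtains g where "g \<in> [V]\<^bsup>2\<^esup> \<rightarrow> {..<q}"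
    and "\<And>K. K \<in> [V]\<^bsup>k\<^esup> \<Longrightarrow> \<not> g ` [K]\<^bsup>2\<^esup> \<subseteq> {r}"
    and "\<And>i K. i < q \<Longrightarrow> i \<noteq> r \<Longrightarrow> K \<in> [V]\<^bsup>m\<^esup> \<Longrightarrow> \<not> g ` [K]\<^bsup>2\<^esup> \<subseteq> {i}"
proof -
  let ?ks = "k # replicate (q - 1) m"
  have len: "length ?ks = q" using assms(3) by simp
  obtain g where g: "g \<in> [V]\<^bsup>2\<^esup> \<rightarrow> {..<q}"
    and no: "\<And>i K. i < q \<Longrightarrow> K \<in> [V]\<^bsup>(?ks ! i)\<^esup> \<Longrightarrow> \<not> g ` [K]\<^bsup>2\<^esup> \<subseteq> {i}"
    using critical_colouring[OF assms(1,2)] unfolding len by blast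
  let ?t = "transpose 0 r"
  have t: "?t i < q" if "i < q" for i
    using that assms(3) by (auto simp: transpose_def)
  \<comment> \<open>The transposition is its own inverse.\<close>
  have tg: "g ` X \<subseteq> {?t i}" if "(?t \<circ> g) ` X \<subseteq> {i}" for X i
    using that by (auto simp: image_subset_iff)
  show thesis
  proof
    show "?t \<circ> g \<in> [V]\<^bsup>2\<^esup> \<rightarrow> {..<q}"
      using g t by fastforce
    show "\<not> (?t \<circ> g) ` [K]\<^bsup>2\<^esup> \<subseteq> {r}" if "K \<in> [V]\<^bsup>k\<^esup>" for K
      using tg[of "[K]\<^bsup>2\<^esup>" r] no[of 0 K] that assms(3) by auto
    fix i K
    assume i: "i < q" "i \<noteq> r" and K: "K \<in> [V]\<^bsup>m\<^esup>"
    have "?t i \<noteq> 0"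
      using i by (auto simp: transpose_def)
    then have "?ks ! ?t i = m"
      using t[OF i(1)] by (cases "?t i") auto
    then show "\<not> (?t \<circ> g) ` [K]\<^bsup>2\<^esup> \<subseteq> {i}"
      using tg[of "[K]\<^bsup>2\<^esup>" i] no[OF t[OF i(1)], of K] K by auto
  qed
qed

section \<open>Transfer of the Ramsey property\<close>

lemma is_ramsey_clique_sum_antimono:
  assumes "finite_simple_graph G" and "j' \<le> j" and "is_ramsey q G (clique_sum a j)"
  shows "is_ramsey q G (clique_sum a j')"
  using assms clique_packing_mono unfolding is_ramsey_clique_sum_iff[OF assms(1)] by meson

text \<open>The substantial direction, with \<open>n\<close> for \<open>s - 1\<close>.\<close>

lemma is_ramsey_clique_sum_Suc:
  fixes G :: "'v ugraph"
  assumes G: "finite_simple_graph G" and "1 \<le> n"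
    and anti: "\<And>i j. 1 \<le> i \<Longrightarrow> i \<le> j \<Longrightarrow> j \<le> Suc n \<Longrightarrow> a j \<le> a i"
    and large: "q * (\<Sum>i=1..n. a i) < ramsey_number ((a 1 - a (Suc n) + 1) # replicate (q - 1) (a 1))"
    and ramsey: "is_ramsey q G (clique_sum a n)"
  shows "is_ramsey q G (clique_sum a (Suc n))"
proof (rule ccontr)
  let ?E = "\<lambda>c i. {e \<in> edges G. c e = i}"
  let ?pack = "\<lambda>j c i. clique_packing a j (verts G) (?E c i)"
  assume "\<not> is_ramsey q G (clique_sum a (Suc n))"
  then obtain c where c: "c \<in> edges G \<rightarrow> {..<q}"
    and noS: "\<And>i C. i < q \<Longrightarrow> \<not> ?pack (Suc n) c i C"
    unfolding is_ramsey_clique_sum_iff[OF G] by blast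
  obtain r where r: "r < q" "\<exists>C. ?pack n c r C"
    using ramsey c unfolding is_ramsey_clique_sum_iff[OF G] by blast
  \<comment> \<open>The last conjunct records that colour \<open>r\<close> reaches level
    \<open>n\<close>, which later gives the stronger bound \<open>a (Suc n)\<close> for cliques of
    colour \<open>r\<close> outside \<open>V\<close>.\<close>
  define maximal where "maximal i j C \<longleftrightarrow>
    j \<le> n \<and> ?pack j c i C \<and> (\<nexists>C'. ?pack (Suc j) c i C') \<and> (i = r \<longrightarrow> j = n)" for i j C
  have "\<exists>j C. maximal i j C" if i: "i < q" for i
  proof -
    define J where "J = (GREATEST j. j \<le> n \<and> (\<exists>C. ?pack j c i C))"
    \<comment> \<open>The empty packing is a candidate, and \<open>n\<close> bounds all candidates,
      so the maximum exists.\<close>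
    have "0 \<le> n \<and> (\<exists>C. ?pack 0 c i C)"
      by (simp add: clique_packing_def disjoint_family_on_def)
    then have J: "J \<le> n" "\<exists>C. ?pack J c i C"
      using GreatestI_nat[of "\<lambda>j. j \<le> n \<and> (\<exists>C. ?pack j c i C)" 0 n] by (auto simp: J_def)
    have max: "j \<le> J" if "j \<le> n" "\<exists>C. ?pack j c i C" for j
      using Greatest_le_nat[of "\<lambda>j. j \<le> n \<and> (\<exists>C. ?pack j c i C)" j n] that by (auto simp: J_def)
    \<comment> \<open>The bound \<open>n\<close> hides level \<open>Suc n\<close> from the maximum;
      there the choice of \<open>c\<close> excludes a packing.\<close>
    have "\<nexists>C'. ?pack (Suc J) c i C'"
    proof (cases "J = n")
      case True
      then show ?thesis using noS[OF i] by simp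
    next
      case False
      then show ?thesis using max[of "Suc J"] J(1) by fastforce
    qed
    moreover have "i = r \<longrightarrow> J = n"
      using max[of n] r(2) J(1) by auto
    ultimately show ?thesis using J unfolding maximal_def by blast
  qed
  then obtain j C where "\<And>i. i < q \<Longrightarrow> maximal i (j i) (C i)"
    by metis
  then have jC: "\<And>i. i < q \<Longrightarrow> j i \<le> n" "\<And>i. i < q \<Longrightarrow> ?pack (j i) c i (C i)"
      "\<And>i. i < q \<Longrightarrow> \<nexists>C'. ?pack (Suc (j i)) c i C'" "j r = n"
    using r(1) unfolding maximal_def by blast+
  define W where "W i = (\<Union>k\<in>{1..j i}. C i k)" for i
  define V where "V = (\<Union>i<q. W i)"
  have outside: "card K < a (Suc (j i))"
    if "i < q" "K \<subseteq> verts G" "[K]\<^bsup>2\<^esup> \<subseteq> ?E c i" "K \<inter> V = {}" "finite K" for i K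
  proof (rule ccontr)
    assume "\<not> card K < a (Suc (j i))"
    moreover have "K \<inter> W i = {}" using that(1,4) by (auto simp: V_def)
    ultimately show False
      using clique_packing_extend[OF jC(2), of i K] jC(3)[of i] that by (auto simp: W_def)
  qed
  have finV: "finite V"
    using clique_packing_card(1)[OF jC(2)] by (auto simp: V_def W_def)
  have "card V \<le> (\<Sum>i<q. card (W i))"
    unfolding V_def by (rule card_UN_le) simp
  also have "\<dots> \<le> (\<Sum>i<q. \<Sum>k=1..n. a k)"
  proof (rule sum_mono)
    fix i assume "i \<in> {..<q}"
    then show "card (W i) \<le> (\<Sum>k=1..n. a k)"
      using clique_packing_card(2)[OF jC(2), of i] jC(1)[of i]
      by (auto simp: W_def intro!: sum_mono2)
  qed
  finally have "card V \<le> q * (\<Sum>k=1..n. a k)" by simp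
  then have "card V < ramsey_number ((a 1 - a (Suc n) + 1) # replicate (q - 1) (a 1))"
    using large by simp
  then obtain g where g: "g \<in> [V]\<^bsup>2\<^esup> \<rightarrow> {..<q}"
    and g_r: "\<And>K. K \<in> [V]\<^bsup>(a 1 - a (Suc n) + 1)\<^esup> \<Longrightarrow> \<not> g ` [K]\<^bsup>2\<^esup> \<subseteq> {r}"
    and g_other: "\<And>i K. i < q \<Longrightarrow> i \<noteq> r \<Longrightarrow> K \<in> [V]\<^bsup>a 1\<^esup> \<Longrightarrow> \<not> g ` [K]\<^bsup>2\<^esup> \<subseteq> {i}"
    using critical_colouring_special_colour[OF finV _ r(1)] by blast
  define c' where "c' e = (if e \<subseteq> V then g e else if e \<inter> V = {} then c e else r)" for e
  have "c' \<in> edges G \<rightarrow> {..<q}"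
    using c g r(1) G by (auto simp: c'_def finite_simple_graph_def nsets_def Pi_iff subset_iff)
  then obtain i D where i: "i < q" and D: "?pack n c' i D"
    using ramsey unfolding is_ramsey_clique_sum_iff[OF G] by blast
  \<comment> \<open>The largest clique of the packing, present because \<open>1 \<le> n\<close>,
    already yields the contradiction.\<close>
  define K where "K = D 1"
  have K: "K \<subseteq> verts G" "finite K" "card K = a 1" "[K]\<^bsup>2\<^esup> \<subseteq> ?E c' i"
    using D \<open>1 \<le> n\<close> by (auto simp: clique_packing_def K_def nsets_def)
  have inside: "g ` [K']\<^bsup>2\<^esup> \<subseteq> {i}" if "K' \<subseteq> K \<inter> V" for K'
  proof clarsimp
    fix e assume "e \<in> [K']\<^bsup>2\<^esup>"
    then have "e \<in> [K]\<^bsup>2\<^esup>" "e \<subseteq> V" using that by (auto simp: nsets_def)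
    then show "g e = i" using K(4) by (auto simp: c'_def split: if_splits)
  qed
  have out_c: "[K']\<^bsup>2\<^esup> \<subseteq> ?E c i" if "K' \<subseteq> K - V" for K'
  proof
    fix e assume "e \<in> [K']\<^bsup>2\<^esup>"
    \<comment> \<open>Being nonempty, \<open>e\<close> cannot both avoid \<open>V\<close> and lie in
      it, so \<open>c'\<close> takes its second branch.\<close>
    then have "e \<in> [K]\<^bsup>2\<^esup>" "\<not> e \<subseteq> V" "e \<inter> V = {}"
      using that by (auto simp: nsets_def card_2_iff)
    then show "e \<in> ?E c i" using K(4) by (auto simp: c'_def split: if_splits)
  qed
  show False
  proof (cases "i = r")
    case True
    have "card (K \<inter> V) \<le> a 1 - a (Suc n)"
    proof (rule ccontr)
      assume "\<not> ?thesis"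
      then have "a 1 - a (Suc n) + 1 \<le> card (K \<inter> V)" by simp
      then obtain K' where "K' \<subseteq> K \<inter> V" "card K' = a 1 - a (Suc n) + 1" "finite K'"
        by (rule obtain_subset_with_card_n)
      then show False
        using g_r[of K'] inside[of K'] True by (auto simp: nsets_def)
    qed
    \<comment> \<open>This keeps the natural-number subtraction \<open>a 1 - a (Suc n)\<close> from
      truncating.\<close>
    moreover have "a (Suc n) \<le> a 1"
      using anti by simp
    moreover have "card K = card (K \<inter> V) + card (K - V)"
      using K(2) by (metis card_Diff_subset_Int card_mono finite_Int inf_le1 le_add_diff_inverse)
    ultimately have "a (Suc n) \<le> card (K - V)"
      using K(3) by simp
    then show False
      using outside[OF i, of "K - V"] out_c[of "K - V"] K(1,2) True jC(4) by auto
  next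
    case False
    \<comment> \<open>An edge crossing the boundary of \<open>V\<close> would have colour
      \<open>r\<close>, not \<open>i\<close>.\<close>
    have "K \<subseteq> V \<or> K \<inter> V = {}"
    proof (rule ccontr)
      assume "\<not> ?thesis"
      then obtain x y where xy: "x \<in> K" "x \<notin> V" "y \<in> K" "y \<in> V" by blast
      then have "{x, y} \<in> [K]\<^bsup>2\<^esup>" by auto
      then have "c' {x, y} = i" using K(4) by blast
      then show False using xy False by (auto simp: c'_def)
    qed
    then show False
    proof
      assume "K \<subseteq> V"
      then show False
        using g_other[OF i False, of K] inside[of K] K by (auto simp: nsets_def)
    next
      assume "K \<inter> V = {}"
      then have "card K < a (Suc (j i))"
        using outside[OF i K(1) _ _ K(2)] out_c[of K] by blast
      \<comment> \<open>Since \<open>Suc (j i) \<le> Suc n\<close>, monotonicity bounds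
        \<open>a (Suc (j i))\<close> by \<open>a 1 = card K\<close>.\<close>
      then show False
        using anti[of 1 "Suc (j i)"] jC(1)[OF i] K(3) by simp
    qed
  qed
qed

text \<open>Minimality tests the Ramsey property only on \<open>G\<close> and its subgraphs, all of
  which are finite simple graphs.\<close>

lemma q_equivalentI:
  assumes "\<And>G :: 'v ugraph. finite_simple_graph G \<Longrightarrow> is_ramsey q G H \<longleftrightarrow> is_ramsey q G H'"
  shows "q_equivalent TYPE('v) q H H'"
  using assms unfolding q_equivalent_def ramsey_minimal_def subgraph_def by blast

theorem theorem4p1:
  fixes q s :: nat and a :: "nat \<Rightarrow> nat"
  assumes "q \<ge> 2" and "s \<ge> 2"
    and "\<And>i. 1 \<le> i \<Longrightarrow> i < s \<Longrightarrow> a i \<ge> a (i + 1)"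
    and "a s \<ge> 1"
    and "ramsey_number ((a 1 - a s + 1) # replicate (q - 1) (a 1)) > q * (\<Sum>i=1..s - 1. a i)"
  shows "q_equivalent TYPE('v) q (clique_sum a s) (clique_sum a (s - 1))"
proof (rule q_equivalentI)
  fix G :: "'v ugraph"
  assume G: "finite_simple_graph G"
  have s: "s = Suc (s - 1)" "1 \<le> s - 1" using assms(2) by auto
  have anti: "a j \<le> a i" if "i \<le> j" "1 \<le> i" "j \<le> s" for i j
    using that
  proof (induction j rule: dec_induct)
    case (step j)
    then show ?case using assms(3)[of j] by fastforce
  qed simp
  show "is_ramsey q G (clique_sum a s) \<longleftrightarrow> is_ramsey q G (clique_sum a (s - 1))"
    using is_ramsey_clique_sum_antimono[OF G, of "s - 1" s q a]
      is_ramsey_clique_sum_Suc[OF G s(2), of a q] anti assms(5) s(1) by auto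
qed

end
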